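(* Let $\omega\in(0,1)\setminus\mathbb{Q}$ have continued fraction coefficients $(a_i)_{i\ge1}$ satisfying $\sum_{i=1}^\infty\frac{1}{a_i}<\infty$, let $a>2$ be a real number, and let $f(x):=\min\{1,ax\}$. Then there exists a continuous function $g:\mathbb{T}^1\to[0,1]$ with $g(\theta)=0$ if and only if $\theta=0$, and with $\log g$ integrable on $\mathbb{T}^1$, such that the upper bounding graph $\varphi^+$ of the map $$T:\mathbb{T}^1\times[0,1]\to\mathbb{T}^1\times[0,1],\qquad T(\theta,x)=(\theta+\omega,\ g(\theta)f(x)),$$ has the following properties, where $\Phi^+=\{(\theta,\varphi^+(\theta)):\theta\in\mathbb{T}^1\}$: $\varphi^+(0)=1$, the point $(0,1)=(0,\varphi^+(0))$ is an isolated point of the topological closure $\overline{\Phi^+}$, and for every integer $n\ge0$ the point $(-n\omega,\varphi^+(-n\omega))$ is an isolated point of $\overline{\Phi^+}$. In particular, $\overline{\Phi^+}\ne\{(\theta,x):0\le x\le\varphi^+(\theta)\}$.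
   Context: $\mathbb{T}^1=\mathbb{R}/\mathbb{Z}$ is the circle. The continued fraction expansion of $\omega$ is $\omega=[0;a_1,a_2,\dots]$. The global attractor of $T$ is $K:=\bigcap_{n=0}^\infty T^n(\mathbb{T}^1\times[0,1])$, and the upper bounding graph is $\varphi^+(\theta):=\max\{x\in[0,1]:(\theta,x)\in K\}$. *)

theory Defs
  imports "HOL-Analysis.Analysis"
begin

section \<open>The circle \<open>\<real>/\<int>\<close>\<close>

quotient_type circle = real / "\<lambda>x y::real. x - y \<in> \<int>"
  morphisms rep_circle circle_of
proof (rule equivpI)
  show "reflp (\<lambda>x y::real. x - y \<in> \<int>)"
    by (simp add: reflp_def)
  show "symp (\<lambda>x y::real. x - y \<in> \<int>)"
    by (metis (no_types, lifting) Ints_minus minus_diff_eq sympI)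
  show "transp (\<lambda>x y::real. x - y \<in> \<int>)"
  proof (rule transpI)
    fix x y z :: real
    assume "x - y \<in> \<int>" "y - z \<in> \<int>"
    then have "(x - y) + (y - z) \<in> \<int>" by (rule Ints_add)
    then show "x - z \<in> \<int>" by simp
  qed
qed

instantiation circle :: ab_group_add
begin

lift_definition zero_circle :: circle is "0 :: real" .

lift_definition plus_circle :: "circle \<Rightarrow> circle \<Rightarrow> circle" is "(+)"
  by (metis Ints_add add_diff_add)

lift_definition uminus_circle :: "circle \<Rightarrow> circle" is "uminus"
  by (metis Ints_minus minus_diff_minus)

lift_definition minus_circle :: "circle \<Rightarrow> circle \<Rightarrow> circle" is "(-)"
proof -
  fix a b c d :: real
  assume "a - b \<in> \<int>" "c - d \<in> \<int>"
  then have "(a - b) - (c - d) \<in> \<int>" by (rule Ints_diff)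
  then show "a - c - (b - d) \<in> \<int>" by (simp add: algebra_simps)
qed

instance
  by standard (transfer, simp add: algebra_simps)+

end

lemma abs_diff_round_cong:
  fixes u v :: real
  assumes "u - v \<in> \<int>"
  shows "\<bar>u - of_int (round u)\<bar> = \<bar>v - of_int (round v)\<bar>"
proof -
  obtain k where k: "u = v + of_int k"
    using assms by (metis Ints_cases add.commute diff_add_cancel)
  have "round u = round v + k"
    using floor_add_int[of "v + 1 / 2" k] by (simp add: k round_def algebra_simps)
  then show ?thesis by (simp add: k)
qed

instantiation circle :: metric_space
begin

lift_definition dist_circle :: "circle \<Rightarrow> circle \<Rightarrow> real"
  is "\<lambda>x y. \<bar>(x - y) - of_int (round (x - y))\<bar>"
proof (rule abs_diff_round_cong)
  fix a b c d :: real
  assume "a - b \<in> \<int>" "c - d \<in> \<int>"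
  then have "(a - b) - (c - d) \<in> \<int>" by (rule Ints_diff)
  then show "a - c - (b - d) \<in> \<int>" by (simp add: algebra_simps)
qed

definition uniformity_circle :: "(circle \<times> circle) filter" where
  "uniformity_circle = (INF e\<in>{0<..}. principal {(x, y). dist x y < e})"

definition open_circle :: "circle set \<Rightarrow> bool" where
  "open_circle U \<longleftrightarrow> (\<forall>x\<in>U. eventually (\<lambda>(x', y). x' = x \<longrightarrow> y \<in> U) uniformity)"

instance
proof
  show "(uniformity :: (circle \<times> circle) filter)
      = (INF e\<in>{0<..}. principal {(x, y). dist x y < e})"
    by (rule uniformity_circle_def)
  show "\<And>U :: circle set. open U
      = (\<forall>x\<in>U. eventually (\<lambda>(x', y). x' = x \<longrightarrow> y \<in> U) uniformity)"
    by (rule open_circle_def)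
  show "(dist x y = 0) = (x = y)" for x y :: circle
  proof (transfer, safe)
    fix x y :: real
    assume "\<bar>x - y - of_int (round (x - y))\<bar> = 0"
    then have "x - y = of_int (round (x - y))" by simp
    then show "x - y \<in> \<int>" by (metis Ints_of_int)
  next
    fix x y :: real
    assume "x - y \<in> \<int>"
    then show "\<bar>x - y - of_int (round (x - y))\<bar> = 0" by (auto elim: Ints_cases)
  qed
  show "dist x y \<le> dist x z + dist y z" for x y z :: circle
  proof transfer
    fix x y z :: real
    have "\<bar>(x - y) - of_int (round (x - y))\<bar>
        \<le> \<bar>(x - y) - of_int (round (x - z) - round (y - z))\<bar>"
      by (rule round_diff_minimal)
    also have "\<dots> \<le> \<bar>(x - z) - of_int (round (x - z))\<bar> + \<bar>(y - z) - of_int (round (y - z))\<bar>"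
      by simp
    finally show "\<bar>(x - y) - of_int (round (x - y))\<bar>
        \<le> \<bar>(x - z) - of_int (round (x - z))\<bar> + \<bar>(y - z) - of_int (round (y - z))\<bar>" .
  qed
qed

end

lemma dist_circle_of_le: "dist (circle_of x) (circle_of y) \<le> dist x y"
  using round_diff_minimal[of "x - y" 0]
  by (simp add: dist_circle.abs_eq dist_real_def)

lemma continuous_on_circle_of: "continuous_on S circle_of"
  unfolding continuous_on_iff
  by (meson dist_circle_of_le order_le_less_trans)

lemma circle_of_eq_iff: "circle_of x = circle_of y \<longleftrightarrow> x - y \<in> \<int>"
  by (rule circle.abs_eq_iff)

lemma surj_circle_of: "\<exists>x. circle_of x = t"
  by (metis Quotient3_abs_rep Quotient3_circle)

text \<open>The metric topology is the quotient topology.\<close>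

lemma open_circle_iff: "open U \<longleftrightarrow> open (circle_of -` U)"
proof
  assume "open U"
  then show "open (circle_of -` U)"
    using continuous_on_circle_of open_vimage by blast
next
  assume U: "open (circle_of -` U)"
  show "open U"
    unfolding open_dist
  proof
    fix t assume t: "t \<in> U"
    obtain x where x: "t = circle_of x" using surj_circle_of by metis
    obtain e where e: "e > 0" "\<And>y. dist y x < e \<Longrightarrow> y \<in> circle_of -` U"
      using U t unfolding open_dist x by auto
    have "s \<in> U" if s: "dist s t < e" for s
    proof -
      obtain y where y: "s = circle_of y" using surj_circle_of by metis
      define z where "z = y - of_int (round (y - x))"
      have "dist z x = dist s t"
        by (simp add: z_def x y dist_circle.abs_eq dist_real_def algebra_simps)
      then have "circle_of z \<in> U" using e(2)[of z] s by auto
      moreover have "circle_of z = s"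
        by (simp add: z_def y circle_of_eq_iff)
      ultimately show ?thesis by simp
    qed
    then show "\<exists>e>0. \<forall>y. dist y t < e \<longrightarrow> y \<in> U" using e(1) by blast
  qed
qed

definition circle_measure :: "circle measure" where
  "circle_measure = distr (restrict_space lborel {0..<1}) borel circle_of"

lemma measurable_circle_of: "circle_of \<in> borel_measurable (restrict_space lborel {0..<1})"
  by (intro measurable_restrict_space1)
     (simp add: borel_measurable_continuous_onI continuous_on_circle_of)


section \<open>Continued fractions\<close>

text \<open>\<open>finite_cf n c\<close> is \<open>[0; c 1, \<dots>, c n]\<close>; the value \<open>c 0\<close> is not used.\<close>

primrec finite_cf :: "nat \<Rightarrow> (nat \<Rightarrow> nat) \<Rightarrow> real" where
  "finite_cf 0 c = 0"
| "finite_cf (Suc n) c = 1 / (real (c 1) + finite_cf n (\<lambda>i. c (Suc i)))"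

text \<open>\<open>\<omega> = [0; c 1, c 2, \<dots>]\<close>\<close>

definition has_cf_expansion :: "real \<Rightarrow> (nat \<Rightarrow> nat) \<Rightarrow> bool" where
  "has_cf_expansion \<omega> c \<longleftrightarrow>
     (\<forall>i\<ge>1. c i \<ge> 1) \<and> (\<lambda>n. finite_cf n c) \<longlonglongrightarrow> \<omega>"


section \<open>Forced maps over a rotation\<close>

definition skew_map ::
    "real \<Rightarrow> (circle \<Rightarrow> real) \<Rightarrow> (real \<Rightarrow> real) \<Rightarrow> circle \<times> real \<Rightarrow> circle \<times> real" where
  "skew_map \<omega> g f = (\<lambda>(\<theta>, x). (\<theta> + circle_of \<omega>, g \<theta> * f x))"

definition global_attractor :: "(circle \<times> real \<Rightarrow> circle \<times> real) \<Rightarrow> (circle \<times> real) set" where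
  "global_attractor T = (\<Inter>n. (T ^^ n) ` (UNIV \<times> {0..1}))"

definition upper_bounding_graph :: "(circle \<times> real \<Rightarrow> circle \<times> real) \<Rightarrow> circle \<Rightarrow> real" where
  "upper_bounding_graph T \<theta> = (GREATEST x. x \<in> {0..1} \<and> (\<theta>, x) \<in> global_attractor T)"

end

theory Submission
  imports Defs
begin

text \<open>
  Let \<open>p\<^sub>n / q\<^sub>n\<close> be the convergents of \<open>\<omega>\<close> and \<open>d\<^sub>n = (-1)\<^sup>n (q\<^sub>n \<omega> - p\<^sub>n) > 0\<close>. Put
  \<open>g = a\<^sup>-\<^sup>h\<close>, where \<open>h\<close> is the sum over \<open>n \<ge> N\<close> of \<open>q\<^sub>n\<close> times a bump that is \<open>1\<close> at
  distance at most \<open>d\<^sub>n - d\<^sub>n\<^sub>+\<^sub>2\<close> from \<open>0\<close> and vanishes from distance \<open>d\<^sub>n\<close> on. Its integral is at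
  most \<open>\<Sum> 2 q\<^sub>n d\<^sub>n \<le> \<Sum> 2 q\<^sub>n / q\<^sub>n\<^sub>+\<^sub>1 \<le> \<Sum> 2 / c\<^sub>n\<^sub>+\<^sub>1\<close>.

  By best approximation, visits of the orbit of \<open>0\<close> to either side of the \<open>d\<^sub>n\<close>-neighbourhood of \<open>0\<close>
  are at least \<open>q\<^sub>n\<^sub>+\<^sub>1\<close> steps apart, so \<open>\<Sum>\<^bsub>j \<le> k\<^esub> h(- j \<omega>) \<le> 2 k \<Sum>\<^bsub>n \<ge> N\<^esub> q\<^sub>n / q\<^sub>n\<^sub>+\<^sub>1\<close>; for large
  \<open>N\<close> this is at most \<open>k - 1\<close>, the expansion available through \<open>a\<close>, and hence \<open>\<phi>\<^sup>+(0) = 1\<close>. On the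
  other hand every \<open>\<theta> \<noteq> 0\<close> near \<open>0\<close> has its distance to \<open>0\<close> in some \<open>[d\<^sub>n\<^sub>+\<^sub>2, d\<^sub>n]\<close> with
  \<open>n\<close> of the parity that puts \<open>q\<^sub>n \<omega>\<close> on the side of \<open>\<theta>\<close>; then \<open>g(\<theta> - q\<^sub>n \<omega>) \<le> a powr - q\<^sub>n\<close> and
  \<open>\<phi>\<^sup>+(\<theta>) \<le> 1 / a\<close>. So \<open>(0, 1)\<close> is isolated, and the points over \<open>- n \<omega>\<close> are isolated because
  \<open>T\<^sup>n\<close> is continuous, preserves the graph and sends them to \<open>(0, 1)\<close>.
\<close>

section \<open>Continued fractions\<close>

lemma finite_cf_bounds:
  assumes "\<forall>i\<ge>1. c i \<ge> 1"
  shows "0 \<le> finite_cf n c \<and> finite_cf n c \<le> 1"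
  using assms
proof (induction n arbitrary: c)
  case (Suc n)
  have "0 \<le> finite_cf n (\<lambda>i. c (Suc i))"
    using Suc.IH[of "\<lambda>i. c (Suc i)"] Suc.prems by simp
  moreover have "1 \<le> real (c 1)" using Suc.prems by simp
  ultimately show ?case by simp
qed simp

lemma has_cf_expansion_bounds:
  assumes "has_cf_expansion \<omega> c" "\<omega> \<notin> \<rat>"
  shows "0 < \<omega>" "\<omega> < 1"
proof -
  have l: "(\<lambda>n. finite_cf n c) \<longlonglongrightarrow> \<omega>" and c: "\<forall>i\<ge>1. c i \<ge> 1"
    using assms(1) by (auto simp: has_cf_expansion_def)
  have "0 \<le> \<omega>" "\<omega> \<le> 1"
    using LIMSEQ_le_const[OF l, of 0] LIMSEQ_le_const2[OF l, of 1] finite_cf_bounds[OF c]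
    by blast+
  moreover have "\<omega> \<noteq> 0" "\<omega> \<noteq> 1" using assms(2) by auto
  ultimately show "0 < \<omega>" "\<omega> < 1" by simp_all
qed

text \<open>One step of the Gauss map: the recursion of \<open>finite_cf\<close>, solved for the
  shifted fraction, passes to the limit because \<omega> is not 0.\<close>

lemma has_cf_expansion_shift:
  assumes "has_cf_expansion \<omega> c" "\<omega> \<notin> \<rat>"
  shows "has_cf_expansion (1 / \<omega> - real (c 1)) (\<lambda>i. c (Suc i))"
proof -
  have l: "(\<lambda>n. finite_cf n c) \<longlonglongrightarrow> \<omega>" and c: "\<forall>i\<ge>1. c i \<ge> 1"
    using assms(1) by (auto simp: has_cf_expansion_def)
  have "(\<lambda>n. inverse (finite_cf (Suc n) c) - real (c 1)) \<longlonglongrightarrow> inverse \<omega> - real (c 1)"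
    using has_cf_expansion_bounds[OF assms] by (intro tendsto_intros LIMSEQ_Suc l) auto
  then have "(\<lambda>n. finite_cf n (\<lambda>i. c (Suc i))) \<longlonglongrightarrow> 1 / \<omega> - real (c 1)"
    by (simp add: inverse_eq_divide)
  then show ?thesis using c by (simp add: has_cf_expansion_def)
qed

section \<open>Convergents and their errors\<close>

fun cf_denom :: "(nat \<Rightarrow> nat) \<Rightarrow> nat \<Rightarrow> nat" where
  "cf_denom c 0 = 1"
| "cf_denom c (Suc 0) = c 1"
| "cf_denom c (Suc (Suc n)) = c (Suc (Suc n)) * cf_denom c (Suc n) + cf_denom c n"

fun cf_num :: "(nat \<Rightarrow> nat) \<Rightarrow> nat \<Rightarrow> nat" where
  "cf_num c 0 = 0"
| "cf_num c (Suc 0) = 1"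
| "cf_num c (Suc (Suc n)) = c (Suc (Suc n)) * cf_num c (Suc n) + cf_num c n"

text \<open>The Gauss map orbit of \<omega>: the \<open>n\<close>-th tail is
  \<open>[0; c (n + 1), c (n + 2), ...]\<close>.\<close>

primrec cf_tail :: "real \<Rightarrow> (nat \<Rightarrow> nat) \<Rightarrow> nat \<Rightarrow> real" where
  "cf_tail \<omega> c 0 = \<omega>"
| "cf_tail \<omega> c (Suc n) = 1 / cf_tail \<omega> c n - real (c (Suc n))"

locale irrational_cf =
  fixes \<omega> :: real and c :: "nat \<Rightarrow> nat"
  assumes irrational: "\<omega> \<notin> \<rat>" and expansion: "has_cf_expansion \<omega> c"
begin

abbreviation "q \<equiv> cf_denom c"
abbreviation "p \<equiv> cf_num c"

text \<open>The product of the tails is \<open>\<bar>q n * \<omega> - p n\<bar>\<close>; in this form its positivity is evident.\<close>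

definition err :: "nat \<Rightarrow> real" where
  "err n = (\<Prod>i\<le>n. cf_tail \<omega> c i)"

lemma c_pos: "i \<ge> 1 \<Longrightarrow> c i \<ge> 1"
  using expansion by (simp add: has_cf_expansion_def)

lemma tail_expansion:
  "cf_tail \<omega> c n \<notin> \<rat> \<and> has_cf_expansion (cf_tail \<omega> c n) (\<lambda>i. c (n + i))"
proof (induction n)
  case 0
  then show ?case using irrational expansion by simp
next
  case (Suc n)
  have "1 / cf_tail \<omega> c n - real (c (Suc n)) \<notin> \<rat>"
  proof
    assume "1 / cf_tail \<omega> c n - real (c (Suc n)) \<in> \<rat>"
    then have "1 / (1 / cf_tail \<omega> c n - real (c (Suc n)) + real (c (Suc n))) \<in> \<rat>"
      by (intro Rats_divide Rats_add) auto
    then show False using Suc by simp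
  qed
  then show ?case
    using has_cf_expansion_shift[of "cf_tail \<omega> c n" "\<lambda>i. c (n + i)"] Suc by simp
qed

lemma tail_bounds: "0 < cf_tail \<omega> c n" "cf_tail \<omega> c n < 1"
  using has_cf_expansion_bounds tail_expansion by blast+

lemma err_pos: "0 < err n"
  unfolding err_def using tail_bounds by (intro prod_pos) auto

lemma err_Suc: "err (Suc n) = err n * cf_tail \<omega> c (Suc n)"
  by (simp add: err_def)

lemma err_Suc_less: "err (Suc n) < err n"
  unfolding err_Suc using err_pos[of n] tail_bounds(2)[of "Suc n"] by (simp del: cf_tail.simps)

lemma err_strict_antimono: "m < n \<Longrightarrow> err n < err m"
  using err_Suc_less by (metis lift_Suc_mono_less[of "\<lambda>n. - err n"] neg_less_iff_less)

lemma err_antimono: "m \<le> n \<Longrightarrow> err n \<le> err m"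
  using err_strict_antimono by (metis le_neq_implies_less less_le order_refl)

lemma err_1: "err (Suc 0) = 1 - real (c 1) * \<omega>"
  using tail_bounds(1)[of 0] by (simp add: err_def field_simps)

lemma err_rec: "err (Suc (Suc n)) = err n - real (c (Suc (Suc n))) * err (Suc n)"
proof -
  have "err (Suc n) / cf_tail \<omega> c (Suc n) = err n"
    using tail_bounds(1)[of "Suc n"] by (simp add: err_Suc)
  then show ?thesis unfolding err_Suc[of "Suc n"] by (simp add: algebra_simps)
qed

text \<open>Both sides obey the same two-term recurrence. The sign records that the points
  \<open>q n * \<omega>\<close> approach 0 alternately from the right and from the left.\<close>

lemma signed_err: "real (q n) * \<omega> - real (p n) = (-1) ^ n * err n"
proof (induction n rule: induct_nat_012)
  case 0
  show ?case by (simp add: err_def)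
next
  case 1
  show ?case by (simp add: err_1)
next
  case (ge2 n)
  have "real (q (Suc (Suc n))) * \<omega> - real (p (Suc (Suc n)))
      = real (c (Suc (Suc n))) * (real (q (Suc n)) * \<omega> - real (p (Suc n)))
        + (real (q n) * \<omega> - real (p n))"
    by (simp add: algebra_simps)
  then show ?case unfolding ge2.IH err_rec by (simp add: algebra_simps)
qed

lemma denom_pos: "0 < q n"
proof (induction n rule: induct_nat_012)
  case 1
  show ?case using c_pos[of 1] by simp
qed auto

lemma denom_step: "c (Suc n) * q n \<le> q (Suc n)"
  by (cases n) auto

lemma denom_ge: "n \<le> q n"
proof (induction n rule: induct_nat_012)
  case 1
  show ?case using c_pos[of 1] by simp
next
  case (ge2 n)
  have "1 * q (Suc n) \<le> c (Suc (Suc n)) * q (Suc n)"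
    using c_pos[of "Suc (Suc n)"] by (intro mult_le_mono1) auto
  then have "q (Suc n) + q n \<le> q (Suc (Suc n))" by simp
  then show ?case using ge2 denom_pos[of n] by linarith
qed simp

text \<open>The recurrences of \<open>q\<close> and \<open>err\<close> cancel, so the left side does
  not depend on \<open>n\<close>.\<close>

lemma denom_err: "real (q (Suc n)) * err n + real (q n) * err (Suc n) = 1"
proof (induction n)
  case 0
  show ?case unfolding err_1 by (simp add: err_def)
next
  case (Suc n)
  then show ?case by (simp add: err_rec algebra_simps)
qed

lemma denom_err_le: "real (q (Suc n)) * err n \<le> 1"
  using denom_err[of n] mult_nonneg_nonneg[of "real (q n)" "err (Suc n)"] err_pos[of "Suc n"]
  by linarith

lemma err_tendsto_0: "err \<longlonglongrightarrow> 0"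
proof (rule tendsto_sandwich[OF _ _ tendsto_const])
  show "\<forall>\<^sub>F n in sequentially. 0 \<le> err n"
    using err_pos by (simp add: less_imp_le)
  have "err n \<le> 1 / real (Suc n)" for n
  proof -
    have "real (Suc n) * err n \<le> real (q (Suc n)) * err n"
      using denom_ge[of "Suc n"] err_pos[of n] by (intro mult_right_mono) linarith+
    then show ?thesis using denom_err_le[of n] by (simp add: field_simps)
  qed
  then show "\<forall>\<^sub>F n in sequentially. err n \<le> 1 / real (Suc n)" by simp
  show "(\<lambda>n. 1 / real (Suc n)) \<longlonglongrightarrow> 0"
    using LIMSEQ_inverse_real_of_nat by (simp add: inverse_eq_divide)
qed

section \<open>Best approximation and return times\<close>

lemma convergent_det: "int (p (Suc n)) * int (q n) - int (p n) * int (q (Suc n)) = (-1) ^ n"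
proof (induction n)
  case (Suc n)
  have "int (p (Suc (Suc n))) * int (q (Suc n)) - int (p (Suc n)) * int (q (Suc (Suc n)))
     = - (int (p (Suc n)) * int (q n) - int (p n) * int (q (Suc n)))"
    by (simp add: algebra_simps)
  then show ?case unfolding Suc by simp
qed simp

text \<open>Lagrange's argument. Two consecutive convergents form a basis of the integer lattice, so
  \<open>(j, m)\<close> is an integer combination of them with coefficients \<open>u\<close> and
  \<open>v\<close>. The range of \<open>j\<close> excludes \<open>u = 0\<close> and equal strict
  signs; in the other cases the two errors add up and \<open>u\<close> contributes at least
  \<open>err n\<close>.\<close>

lemma best_approximation:
  fixes j m :: int
  assumes "1 \<le> j" "j < int (q (Suc n))"
  shows "err n \<le> \<bar>of_int j * \<omega> - of_int m\<bar>"
proof -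
  define Q Q' P P' s where "Q = int (q n)" "Q' = int (q (Suc n))"
    "P = int (p n)" "P' = int (p (Suc n))" "s = (-1 :: int) ^ n"
  note defs = this
  have det: "P' * Q - P * Q' = s" and ss: "s * s = 1"
    using convergent_det[of n] by (simp_all add: defs power_mult_distrib[symmetric])
  have Q: "0 < Q" "0 < Q'" using denom_pos by (auto simp: defs)
  \<comment> \<open>Cramer's rule; the determinant \<open>s\<close> is its own inverse.\<close>
  define u v where "u = s * (j * P' - m * Q')" "v = s * (m * Q - j * P)"
  note uv = this
  \<comment> \<open>The consecutive errors have opposite signs, so if \<open>u\<close> and \<open>v\<close> have opposite signs the two
    contributions to \<open>j * \<omega> - m\<close> do not cancel.\<close>
  have j: "j = u * Q + v * Q'"
  proof -
    have "u * Q + v * Q' = s * (j * (P' * Q - P * Q'))" by (simp add: uv algebra_simps)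
    then show ?thesis using ss by (simp add: det algebra_simps)
  qed
  have m: "m = u * P + v * P'"
  proof -
    have "u * P + v * P' = s * (m * (P' * Q - P * Q'))" by (simp add: uv algebra_simps)
    then show ?thesis using ss by (simp add: det algebra_simps)
  qed
  have e: "of_int Q * \<omega> - of_int P = of_int s * err n"
    "of_int Q' * \<omega> - of_int P' = - of_int s * err (Suc n)"
    using signed_err[of n] signed_err[of "Suc n"] by (simp_all add: defs)
  have "of_int j * \<omega> - of_int m
      = of_int u * (of_int Q * \<omega> - of_int P) + of_int v * (of_int Q' * \<omega> - of_int P')"
    by (subst j, subst m) (simp add: algebra_simps)
  then have eq: "of_int j * \<omega> - of_int m = of_int s * (of_int u * err n - of_int v * err (Suc n))"
    unfolding e by (simp add: algebra_simps)
  have "\<bar>of_int s :: real\<bar> = 1" by (simp add: defs power_abs)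
  then have abs: "\<bar>of_int j * \<omega> - of_int m\<bar> = \<bar>of_int u * err n - of_int v * err (Suc n)\<bar>"
    unfolding eq abs_mult by simp
  have jQ: "1 \<le> j" "j < Q'" using assms by (auto simp: defs)
  consider "u = 0" | "u \<ge> 1" "v \<ge> 1" | "u \<ge> 1" "v \<le> 0" | "u \<le> -1" "v \<ge> 0" | "u \<le> -1" "v \<le> -1"
    by linarith
  then show ?thesis
  proof cases
    case 1
    have "v \<le> 0 \<or> 1 \<le> v" by linarith
    then have "v * Q' \<le> 0 \<or> 1 * Q' \<le> v * Q'"
      using Q mult_right_mono[of 1 v Q'] by (auto simp: mult_le_0_iff)
    moreover have "j = v * Q'" using j 1 by simp
    ultimately show ?thesis using jQ by linarith
  next
    case 2
    have "0 \<le> u * Q" using 2 Q by simp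
    moreover have "1 * Q' \<le> v * Q'" using 2 Q by (intro mult_right_mono) auto
    ultimately show ?thesis using jQ j by linarith
  next
    case 3
    have "1 * err n \<le> of_int u * err n"
      using 3 err_pos[of n] by (intro mult_right_mono) auto
    moreover have "of_int v * err (Suc n) \<le> 0"
      using 3 err_pos[of "Suc n"] by (simp add: mult_le_0_iff)
    ultimately show ?thesis unfolding abs by linarith
  next
    case 4
    have "of_int u \<le> (-1 :: real)" using 4 by linarith
    then have "of_int u * err n \<le> (-1) * err n"
      using err_pos[of n] by (intro mult_right_mono) auto
    moreover have "of_int v * err (Suc n) \<ge> 0"
      using 4 err_pos[of "Suc n"] by simp
    ultimately show ?thesis unfolding abs by linarith
  next
    case 5
    have "u * Q \<le> 0" "v * Q' \<le> 0" using 5 Q by (auto simp: mult_le_0_iff)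
    then show ?thesis using jQ j by linarith
  qed
qed

text \<open>Each block of \<open>Q\<close> consecutive times contains at most one element of
  \<open>A\<close>, and the block starting at 0 contains none.\<close>

lemma card_returns_one_side:
  assumes gap: "\<And>i j. \<lbrakk>i \<in> A; j \<in> A; i < j\<rbrakk> \<Longrightarrow> Q \<le> j - i"
    and A: "A \<subseteq> {Q..k}" and Q: "0 < (Q::nat)"
  shows "card A \<le> k div Q"
proof -
  have "inj_on (\<lambda>j. j div Q) A"
  proof (rule linorder_inj_onI)
    fix i j assume "i < j" "i \<in> A" "j \<in> A"
    then have "i + Q \<le> j" using gap by fastforce
    then have "(i + Q) div Q \<le> j div Q" by (rule div_le_mono)
    then show "i div Q \<noteq> j div Q" using Q by simp
  qed auto
  moreover have "(\<lambda>j. j div Q) ` A \<subseteq> {1..k div Q}"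
  proof safe
    fix j assume "j \<in> A"
    then have "Q \<le> j" "j \<le> k" using A by auto
    then show "j div Q \<in> {1..k div Q}"
      using Q div_le_mono[of Q j Q] div_le_mono[of j k Q] by simp
  qed
  ultimately show ?thesis using card_inj_on_le[of _ A "{1..k div Q}"] by fastforce
qed

text \<open>Two visits on the same side of 0 lie less than \<open>err n\<close> apart, so best
  approximation separates their times. Visits on opposite sides need not be that close, hence the
  split and the factor 2.\<close>

lemma card_returns:
  "card {j \<in> {1..k}. \<bar>real j * \<omega> - of_int (round (real j * \<omega>))\<bar> < err n} \<le> 2 * (k div q (Suc n))"
proof -
  define s where "s j = real j * \<omega> - of_int (round (real j * \<omega>))" for j :: nat
  have near: "q (Suc n) \<le> j - i" if "i < j" "\<bar>s j - s i\<bar> < err n" for i j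
  proof (rule ccontr)
    assume "\<not> ?thesis"
    then have "err n \<le> \<bar>of_int (int (j - i)) * \<omega>
        - of_int (round (real j * \<omega>) - round (real i * \<omega>))\<bar>"
      using \<open>i < j\<close> by (intro best_approximation) auto
    also have "\<dots> = \<bar>s j - s i\<bar>"
      using \<open>i < j\<close> by (simp add: s_def of_nat_diff algebra_simps)
    finally show False using that by simp
  qed
  \<comment> \<open>Time 0 is itself a visit, at distance 0. So the first visit is late as well, and
    the count has no additive constant.\<close>
  have first: "q (Suc n) \<le> j" if "1 \<le> j" "\<bar>s j\<bar> < err n" for j
    using near[of 0 j] that by (simp add: s_def)
  define A B where "A = {j \<in> {1..k}. 0 \<le> s j \<and> s j < err n}"
    and "B = {j \<in> {1..k}. - err n < s j \<and> s j < 0}"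
  have "card A \<le> k div q (Suc n)"
  proof (rule card_returns_one_side)
    show "A \<subseteq> {q (Suc n)..k}" using first by (fastforce simp: A_def)
    show "q (Suc n) \<le> j - i" if "i \<in> A" "j \<in> A" "i < j" for i j
      using that by (intro near) (auto simp: A_def)
  qed (rule denom_pos)
  moreover have "card B \<le> k div q (Suc n)"
  proof (rule card_returns_one_side)
    show "B \<subseteq> {q (Suc n)..k}" using first by (fastforce simp: B_def)
    show "q (Suc n) \<le> j - i" if "i \<in> B" "j \<in> B" "i < j" for i j
      using that by (intro near) (auto simp: B_def)
  qed (rule denom_pos)
  moreover have "{j \<in> {1..k}. \<bar>s j\<bar> < err n} = A \<union> B" by (auto simp: A_def B_def)
  ultimately show ?thesis unfolding s_def[symmetric]
    using card_Un_le[of A B] by simp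
qed

end

section \<open>The circle\<close>

lemma dist_circle_of_0: "dist (circle_of x) 0 = \<bar>x - of_int (round x)\<bar>"
  by (simp add: zero_circle.abs_eq dist_circle.abs_eq)

lemma circle_of_diff: "circle_of x - circle_of y = circle_of (x - y)"
  by (rule minus_circle.abs_eq)

lemma circle_of_add: "circle_of x + circle_of y = circle_of (x + y)"
  by (rule plus_circle.abs_eq)

lemma circle_of_0: "circle_of 0 = 0"
  by (simp add: zero_circle.abs_eq)

lemma dist_circle_translate: "dist (s + u) (t + u) = dist s (t :: circle)"
  by transfer simp

lemma continuous_on_circle_translate: "continuous_on S (\<lambda>t. t + u :: circle)"
  unfolding continuous_on_iff dist_circle_translate by blast

lemma dist_circle_uminus_0: "dist (- t) 0 = dist t (0 :: circle)"
proof -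
  have "dist (- t) 0 = dist 0 t" using dist_circle_translate[of "- t" t 0] by simp
  then show ?thesis by (simp add: dist_commute)
qed

lemma circle_representative:
  obtains x where "t = circle_of x" "\<bar>x\<bar> = dist t 0"
proof -
  obtain y where y: "t = circle_of y" using surj_circle_of by metis
  show thesis
  proof (rule that)
    show "t = circle_of (y - of_int (round y))" by (simp add: y circle_of_eq_iff)
    show "\<bar>y - of_int (round y)\<bar> = dist t 0" by (simp add: y dist_circle_of_0)
  qed
qed

section \<open>Lebesgue measure on the circle\<close>

lemma sets_circle_measure [simp, measurable_cong]: "sets circle_measure = sets borel"
  by (simp add: circle_measure_def)

lemma space_circle_measure [simp]: "space circle_measure = UNIV"
  by (simp add: circle_measure_def)

lemma borel_measurable_circle_measure:
  "continuous_on UNIV h \<Longrightarrow> h \<in> borel_measurable circle_measure"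
  using borel_measurable_continuous_onI[of h]
  by (simp add: measurable_cong_sets[OF sets_circle_measure refl])

lemma emeasure_circle_measure:
  assumes "A \<in> sets borel"
  shows "emeasure circle_measure A = emeasure lborel {x \<in> {0..<1}. circle_of x \<in> A}"
proof -
  have "emeasure circle_measure A
      = emeasure (restrict_space lborel {0..<1})
          (circle_of -` A \<inter> space (restrict_space lborel {0..<1}))"
    unfolding circle_measure_def using measurable_circle_of assms by (rule emeasure_distr)
  also have "circle_of -` A \<inter> space (restrict_space lborel {0..<1}) = {x \<in> {0..<1}. circle_of x \<in> A}"
    by (auto simp: space_restrict_space)
  also have "emeasure (restrict_space lborel {0..<1}) \<dots> = emeasure lborel \<dots>"
    by (intro emeasure_restrict_space) auto
  finally show ?thesis .
qed

lemma finite_measure_circle_measure: "finite_measure circle_measure"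
proof
  have "{x \<in> {0::real..<1}. circle_of x \<in> UNIV} = {0..<1}" by auto
  then have "emeasure circle_measure (space circle_measure) = emeasure lborel {0::real..<1}"
    by (simp only: emeasure_circle_measure space_circle_measure borel_open open_UNIV)
  then show "emeasure circle_measure (space circle_measure) \<noteq> \<infinity>" by simp
qed

text \<open>The penalty series below diverges at 0, where every bump equals 1; integration may
  ignore this point.\<close>

lemma AE_circle_nonzero: "AE \<theta> in circle_measure. \<theta> \<noteq> 0"
proof (rule AE_I)
  have "{x \<in> {0::real..<1}. circle_of x \<in> {0}} \<subseteq> {0}"
    by (auto simp: circle_of_0[symmetric] circle_of_eq_iff elim!: Ints_cases)
  then have "emeasure lborel {x \<in> {0::real..<1}. circle_of x \<in> {0}} \<le> emeasure lborel {0::real}"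
    by (rule emeasure_mono) simp
  then show "emeasure circle_measure {0} = 0"
    by (subst emeasure_circle_measure) simp_all
qed auto

text \<open>In the fundamental domain \<open>[0, 1)\<close> a ball around 0 shows up at both ends,
  covered by one interval of length \<open>r\<close> at each.\<close>

lemma measure_circle_ball_le:
  assumes "0 \<le> r"
  shows "measure circle_measure {\<theta>. dist \<theta> 0 < r} \<le> 2 * r"
proof -
  have "{\<theta> :: circle. dist \<theta> 0 < r} = ball 0 r" by (auto simp: dist_commute)
  then have meas: "{\<theta> :: circle. dist \<theta> 0 < r} \<in> sets borel" by simp
  have "{x \<in> {0::real..<1}. circle_of x \<in> {\<theta>. dist \<theta> 0 < r}} \<subseteq> {0..r} \<union> {1 - r..1}"
  proof clarsimp
    fix x :: real assume x: "0 \<le> x" "x < 1" "dist (circle_of x) 0 < r" "\<not> 1 - r \<le> x"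
    show "x \<le> r"
    proof (cases "x < 1/2")
      case True
      then have "round x = 0" using x by (intro round_unique') auto
      then show ?thesis using x by (simp add: dist_circle_of_0)
    next
      case False
      then have "round x = 1" using x by (intro round_unique) auto
      then show ?thesis using x by (simp add: dist_circle_of_0)
    qed
  qed
  then have "emeasure circle_measure {\<theta>. dist \<theta> 0 < r} \<le> emeasure lborel ({0..r} \<union> {1 - r..1})"
    unfolding emeasure_circle_measure[OF meas] by (rule emeasure_mono) auto
  also have "\<dots> \<le> emeasure lborel {0..r} + emeasure lborel {1 - r..1}"
    by (intro emeasure_subadditive) auto
  also have "\<dots> = ennreal (2 * r)"
    using assms by (simp add: ennreal_plus[symmetric] del: ennreal_plus)
  finally show ?thesis
    using assms by (simp add: measure_def enn2real_leI)
qed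

section \<open>The upper bounding graph\<close>

text \<open>The open box \<open>ball x r \<times> {b<..}\<close> meets the graph in one point only.
  An open set meets a closure inside the closure of its trace, so the same holds for the closure of
  the graph.\<close>

lemma graph_isolated_point:
  fixes \<phi> :: "'a::metric_space \<Rightarrow> real"
  assumes "0 < r" "b < \<phi> x" and gap: "\<And>\<theta>. \<lbrakk>\<theta> \<noteq> x; dist \<theta> x < r\<rbrakk> \<Longrightarrow> \<phi> \<theta> \<le> b"
  shows "(x, \<phi> x) isolated_in closure {(\<theta>, \<phi> \<theta>) |\<theta>. True}"
    and "\<lbrakk>b < y; y < \<phi> x\<rbrakk> \<Longrightarrow> (x, y) \<notin> closure {(\<theta>, \<phi> \<theta>) |\<theta>. True}"
proof -
  define A where "A = {(\<theta>, \<phi> \<theta>) |\<theta>. True}"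
  define U where "U = ball x r \<times> {b<..}"
  have "open U" unfolding U_def by (intro open_Times) auto
  have "U \<inter> A \<subseteq> {(x, \<phi> x)}"
  proof
    fix w assume "w \<in> U \<inter> A"
    then obtain \<theta> where w: "w = (\<theta>, \<phi> \<theta>)" "dist \<theta> x < r" "b < \<phi> \<theta>"
      by (auto simp: U_def A_def dist_commute)
    then have "\<theta> = x" using gap[of \<theta>] by linarith
    then show "w \<in> {(x, \<phi> x)}" using w by simp
  qed
  then have sub: "U \<inter> closure A \<subseteq> {(x, \<phi> x)}"
    using open_Int_closure_subset[OF \<open>open U\<close>, of A] closure_mono[of "U \<inter> A" "{(x, \<phi> x)}"] by auto
  have "(x, \<phi> x) \<in> U \<inter> closure A"
    using assms(1,2) closure_subset[of A] by (auto simp: U_def A_def)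
  then have "U \<inter> closure A = {(x, \<phi> x)}" using sub by blast
  then show "(x, \<phi> x) isolated_in closure {(\<theta>, \<phi> \<theta>) |\<theta>. True}"
    unfolding A_def[symmetric] isolated_in_def using \<open>open U\<close> by blast
  show "(x, y) \<notin> closure {(\<theta>, \<phi> \<theta>) |\<theta>. True}" if "b < y" "y < \<phi> x"
  proof -
    have "(x, y) \<in> U" using that assms(1) by (simp add: U_def)
    then show ?thesis unfolding A_def[symmetric] using sub that by auto
  qed
qed

text \<open>The isolating neighbourhood is pulled back along \<open>S\<close>. The fibre condition
  speaks of points of \<open>A\<close> only, since the skew map is injective on its graph but not on
  the whole space.\<close>

lemma isolated_in_closure_preimage:
  fixes S :: "'a::t1_space \<Rightarrow> 'a"
  assumes S: "continuous_on UNIV S" and invariant: "\<And>w. w \<in> A \<Longrightarrow> S w \<in> A"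
    and iso: "S z isolated_in closure A" and z: "z \<in> A"
    and fibre: "\<And>w. \<lbrakk>w \<in> A; S w = S z\<rbrakk> \<Longrightarrow> w = z"
  shows "z isolated_in closure A"
proof -
  obtain U where U: "open U" "U \<inter> closure A = {S z}"
    using iso by (auto simp: isolated_in_def)
  have "open (S -` U)" using U(1) S by (rule open_vimage)
  have "S -` U \<inter> A \<subseteq> {z}"
    using U(2) invariant fibre closure_subset[of A] by blast
  then have "S -` U \<inter> closure A \<subseteq> {z}"
    using open_Int_closure_subset[OF \<open>open (S -` U)\<close>, of A] closure_mono[of "S -` U \<inter> A" "{z}"]
    by auto
  moreover have "z \<in> closure A" using z closure_subset by blast
  moreover have "z \<in> S -` U" using U(2) by auto
  ultimately show ?thesis
    unfolding isolated_in_def using \<open>open (S -` U)\<close> by blast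
qed

text \<open>The fibre of \<open>T\<^sup>n(circle \<times> [0, 1])\<close> over \<open>\<theta>\<close> is the interval from \<open>0\<close> to the \<open>n\<close>-th iterate.\<close>

primrec upper_iterate :: "real \<Rightarrow> (circle \<Rightarrow> real) \<Rightarrow> (real \<Rightarrow> real) \<Rightarrow> nat \<Rightarrow> circle \<Rightarrow> real" where
  "upper_iterate \<omega> g f 0 \<theta> = 1"
| "upper_iterate \<omega> g f (Suc n) \<theta>
     = g (\<theta> - circle_of \<omega>) * f (upper_iterate \<omega> g f n (\<theta> - circle_of \<omega>))"

section \<open>Dynamics of the truncated linear skew product\<close>

locale truncated_linear_skew =
  fixes \<omega> a :: real and g :: "circle \<Rightarrow> real"
  assumes a: "a > 1" and g_nonneg: "\<And>\<theta>. 0 \<le> g \<theta>" and g_le_1: "\<And>\<theta>. g \<theta> \<le> 1"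
begin

abbreviation "f \<equiv> (\<lambda>x::real. min 1 (a * x))"
abbreviation "T \<equiv> skew_map \<omega> g f"
abbreviation "\<phi> \<equiv> upper_bounding_graph T"
abbreviation "u \<equiv> upper_iterate \<omega> g f"
abbreviation "R \<equiv> circle_of \<omega>"

lemma iterate_bounds: "0 \<le> u n \<theta> \<and> u n \<theta> \<le> 1"
proof (induction n arbitrary: \<theta>)
  case (Suc n)
  have "0 \<le> f (u n (\<theta> - R))" "f (u n (\<theta> - R)) \<le> 1"
    using Suc a by auto
  then show ?case using g_nonneg g_le_1 by (simp add: mult_le_one)
qed simp

lemma f_mono: "x \<le> y \<Longrightarrow> f x \<le> f y"
  using a by (simp add: min.coboundedI2 min_le_iff_disj)

lemma iterate_decreasing: "u (Suc n) \<theta> \<le> u n \<theta>"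
proof (induction n arbitrary: \<theta>)
  case 0
  show ?case using iterate_bounds[of "Suc 0"] by simp
next
  case (Suc n)
  show ?case
    unfolding upper_iterate.simps(2)[of _ _ _ "Suc n"] upper_iterate.simps(2)[of _ _ _ n \<theta>]
    by (intro mult_left_mono f_mono Suc g_nonneg)
qed

lemma attractor_fibre:
  "(\<theta>, x) \<in> (T ^^ n) ` (UNIV \<times> {0..1}) \<longleftrightarrow> 0 \<le> x \<and> x \<le> u n \<theta>"
proof (induction n arbitrary: \<theta> x)
  case (Suc n)
  have "(T ^^ n) ` (UNIV \<times> {0..1}) = {(\<eta>, y). 0 \<le> y \<and> y \<le> u n \<eta>}"
    by (rule set_eqI) (simp only: split_paired_all Suc mem_Collect_eq case_prod_conv)
  then have "(T ^^ Suc n) ` (UNIV \<times> {0..1}) = T ` {(\<eta>, y). 0 \<le> y \<and> y \<le> u n \<eta>}"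
    by (simp only: funpow.simps image_comp[symmetric])
  moreover have "(\<theta>, x) \<in> T ` {(\<eta>, y). 0 \<le> y \<and> y \<le> u n \<eta>}
      \<longleftrightarrow> (\<exists>y. 0 \<le> y \<and> y \<le> u n (\<theta> - R) \<and> x = g (\<theta> - R) * f y)"
  proof
    assume "(\<theta>, x) \<in> T ` {(\<eta>, y). 0 \<le> y \<and> y \<le> u n \<eta>}"
    then obtain \<eta> y where y: "0 \<le> y" "y \<le> u n \<eta>" "(\<theta>, x) = T (\<eta>, y)"
      by (elim imageE CollectE case_prodE conjE) metis
    then have "\<eta> = \<theta> - R" "x = g \<eta> * f y" by (simp_all add: skew_map_def)
    then show "\<exists>y. 0 \<le> y \<and> y \<le> u n (\<theta> - R) \<and> x = g (\<theta> - R) * f y"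
      using y(1,2) by blast
  next
    assume "\<exists>y. 0 \<le> y \<and> y \<le> u n (\<theta> - R) \<and> x = g (\<theta> - R) * f y"
    then obtain y where "0 \<le> y" "y \<le> u n (\<theta> - R)" "x = g (\<theta> - R) * f y" by blast
    then show "(\<theta>, x) \<in> T ` {(\<eta>, y). 0 \<le> y \<and> y \<le> u n \<eta>}"
      by (intro image_eqI[of _ _ "(\<theta> - R, y)"]) (simp_all add: skew_map_def)
  qed
  ultimately have "(\<theta>, x) \<in> (T ^^ Suc n) ` (UNIV \<times> {0..1})
      \<longleftrightarrow> (\<exists>y. 0 \<le> y \<and> y \<le> u n (\<theta> - R) \<and> x = g (\<theta> - R) * f y)"
    by simp
  also have "\<dots> \<longleftrightarrow> 0 \<le> x \<and> x \<le> u (Suc n) \<theta>"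
  proof safe
    fix y assume y: "0 \<le> y" "y \<le> u n (\<theta> - R)"
    show "0 \<le> g (\<theta> - R) * f y" using y a g_nonneg by simp
    show "g (\<theta> - R) * f y \<le> u (Suc n) \<theta>"
      using f_mono[OF y(2)] g_nonneg by (simp add: mult_left_mono)
  next
    assume x: "0 \<le> x" "x \<le> u (Suc n) \<theta>"
    show "\<exists>y. 0 \<le> y \<and> y \<le> u n (\<theta> - R) \<and> x = g (\<theta> - R) * f y"
    \<comment> \<open>Where \<open>g\<close> vanishes the new fibre is \<open>{0}\<close>, and
      height 0 is a preimage.\<close>
    proof (cases "g (\<theta> - R) = 0")
      case True
      then show ?thesis using x iterate_bounds by (intro exI[of _ 0]) auto
    next
      case False
      then have g: "0 < g (\<theta> - R)" using g_nonneg by (simp add: less_le)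
      have "x / g (\<theta> - R) \<le> f (u n (\<theta> - R))"
        using x(2) g by (simp only: upper_iterate.simps(2) pos_divide_le_eq mult.commute[of _ "g (\<theta> - R)"])
      then have le: "x / g (\<theta> - R) \<le> 1" "x / g (\<theta> - R) \<le> a * u n (\<theta> - R)" by auto
      \<comment> \<open>The preimage is taken on the linear branch of \<open>f\<close>, where a
        height is multiplied by \<open>a\<close>.\<close>
      show ?thesis
      proof (intro exI conjI)
        show "0 \<le> x / g (\<theta> - R) / a" using x g a by simp
        show "x / g (\<theta> - R) / a \<le> u n (\<theta> - R)"
          using le(2) a by (simp only: pos_divide_le_eq mult.commute[of _ a])
        have "f (x / g (\<theta> - R) / a) = x / g (\<theta> - R)" using le(1) a by simp
        then show "x = g (\<theta> - R) * f (x / g (\<theta> - R) / a)" using g by simp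
      qed
    qed
  qed
  finally show ?case .
qed auto

lemma bdd_iterate: "bdd_below (range (\<lambda>n. u n \<theta>))"
  using iterate_bounds by (intro bdd_belowI2[of _ 0]) auto

text \<open>The attractor fibre is an intersection of closed intervals starting at 0, so the infimum
  of their tops belongs to it and is its maximum.\<close>

lemma graph_eq_Inf: "\<phi> \<theta> = (INF n. u n \<theta>)"
  unfolding upper_bounding_graph_def
proof (rule Greatest_equality)
  have "0 \<le> (INF n. u n \<theta>)" using iterate_bounds by (intro cINF_greatest) auto
  moreover have le: "(INF n. u n \<theta>) \<le> u m \<theta>" for m
    by (intro cINF_lower bdd_iterate UNIV_I)
  ultimately show "(INF n. u n \<theta>) \<in> {0..1} \<and> (\<theta>, INF n. u n \<theta>) \<in> global_attractor T"
    using le[of 0] unfolding global_attractor_def INT_iff attractor_fibre by simp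
  fix y assume "y \<in> {0..1} \<and> (\<theta>, y) \<in> global_attractor T"
  then have "y \<le> u n \<theta>" for n
    unfolding global_attractor_def INT_iff attractor_fibre by simp
  then show "y \<le> (INF n. u n \<theta>)" by (intro cINF_greatest) auto
qed

lemma iterate_tendsto_graph: "(\<lambda>n. u n \<theta>) \<longlonglongrightarrow> \<phi> \<theta>"
  unfolding graph_eq_Inf
  by (intro LIMSEQ_decseq_INF bdd_iterate decseq_SucI iterate_decreasing)

lemma graph_le_iterate: "\<phi> \<theta> \<le> u n \<theta>"
  unfolding graph_eq_Inf by (intro cINF_lower bdd_iterate UNIV_I)

text \<open>The recursion of \<open>upper_iterate\<close> passes to the limit by continuity of
  \<open>f\<close>.\<close>

lemma graph_invariant: "T (\<theta>, \<phi> \<theta>) = (\<theta> + R, \<phi> (\<theta> + R))"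
proof -
  have "(\<lambda>n. g \<theta> * f (u n \<theta>)) \<longlonglongrightarrow> g \<theta> * f (\<phi> \<theta>)"
    by (intro tendsto_intros iterate_tendsto_graph)
  moreover have "(\<lambda>n. g \<theta> * f (u n \<theta>)) \<longlonglongrightarrow> \<phi> (\<theta> + R)"
    using LIMSEQ_Suc[OF iterate_tendsto_graph[of "\<theta> + R"]] by simp
  ultimately have "\<phi> (\<theta> + R) = g \<theta> * f (\<phi> \<theta>)" using LIMSEQ_unique by blast
  then show ?thesis by (simp add: skew_map_def)
qed

lemma graph_invariant_iterate:
  "(T ^^ n) (\<theta>, \<phi> \<theta>) = (\<theta> + circle_of (real n * \<omega>), \<phi> (\<theta> + circle_of (real n * \<omega>)))"
proof (induction n)
  case 0
  show ?case by (simp add: circle_of_0)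
next
  case (Suc n)
  have "circle_of (real (Suc n) * \<omega>) = circle_of (real n * \<omega>) + R"
    by (simp add: circle_of_add algebra_simps)
  then show ?case using Suc graph_invariant by (simp add: add.assoc)
qed

text \<open>A small value of \<open>g\<close> persists: every later step expands by at most
  \<open>a\<close>. At the visit itself \<open>f\<close> is at most 1, so only \<open>n\<close> of
  the \<open>Suc n\<close> steps contribute a factor \<open>a\<close>.\<close>

lemma graph_le_of_visit:
  assumes "g (\<theta> - circle_of (real (Suc n) * \<omega>)) \<le> b"
  shows "\<phi> \<theta> \<le> a ^ n * b"
proof -
  have "u (Suc n) \<theta> \<le> a ^ n * g (\<theta> - circle_of (real (Suc n) * \<omega>))"
  proof (induction n arbitrary: \<theta>)
    case 0
    show ?case using a by simp
  next
    case (Suc n)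
    have shift: "\<theta> - R - circle_of (real (Suc n) * \<omega>) = \<theta> - circle_of (real (Suc (Suc n)) * \<omega>)"
      by (simp add: diff_diff_eq circle_of_add algebra_simps)
    have "u (Suc (Suc n)) \<theta> \<le> 1 * f (u (Suc n) (\<theta> - R))"
      unfolding upper_iterate.simps(2)[of _ _ _ "Suc n"]
      using iterate_bounds[of "Suc n" "\<theta> - R"] a by (intro mult_right_mono g_le_1) auto
    also have "\<dots> \<le> a * u (Suc n) (\<theta> - R)" by simp
    also have "\<dots> \<le> a * (a ^ n * g (\<theta> - R - circle_of (real (Suc n) * \<omega>)))"
      using a by (intro mult_left_mono Suc) auto
    finally show ?case unfolding shift by (simp add: mult.assoc)
  qed
  also have "\<dots> \<le> a ^ n * b" using assms a by (intro mult_left_mono) auto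
  finally show ?thesis using graph_le_iterate[of \<theta> "Suc n"] by linarith
qed

text \<open>Expanding \<open>f\<close> as a minimum, \<open>u n\<close> for \<open>n > 0\<close> is
  the least of these products over \<open>k < n\<close>: the \<open>k\<close>-th one belongs to a
  history saturated \<open>Suc k\<close> steps ago and linear since. The induction peels off the
  most recent factor of \<open>g\<close>, changing \<open>y\<close> along with \<theta>.\<close>

lemma graph_ge:
  assumes "y \<le> 1"
    and "\<And>k. y \<le> a ^ k * (\<Prod>j=1..Suc k. g (\<theta> - circle_of (real j * \<omega>)))"
  shows "y \<le> \<phi> \<theta>"
proof -
  have "y \<le> u n \<theta>" for n
    using assms
  proof (induction n arbitrary: \<theta> y)
    case (Suc n)
    define b where "b = g (\<theta> - R)"
    have b: "0 \<le> b" "y \<le> b" using g_nonneg Suc.prems(2)[of 0] by (auto simp: b_def)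
    show ?case
    proof (cases "y \<le> 0")
      case True
      then show ?thesis using iterate_bounds[of "Suc n" \<theta>] by linarith
    next
      case False
      then have "0 < b" using b by linarith
      \<comment> \<open>\<open>y / (a * b)\<close> is the height that the linear branch followed by
        the factor \<open>b\<close> sends to \<open>y\<close>; the cap preserves the first
        hypothesis.\<close>
      have "min 1 (y / (a * b)) \<le> u n (\<theta> - R)"
      proof (rule Suc.IH)
        fix k
        have shift: "\<theta> - R - circle_of (real j * \<omega>) = \<theta> - circle_of (real (Suc j) * \<omega>)" for j
          by (simp add: diff_diff_eq circle_of_add distrib_right)
        have "(\<Prod>j=1..Suc (Suc k). g (\<theta> - circle_of (real j * \<omega>)))
            = g (\<theta> - circle_of (real 1 * \<omega>))
              * (\<Prod>j=Suc 1..Suc (Suc k). g (\<theta> - circle_of (real j * \<omega>)))"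
          by (rule prod.atLeast_Suc_atMost) simp
        also have "\<dots> = b * (\<Prod>j=1..Suc k. g (\<theta> - R - circle_of (real j * \<omega>)))"
          unfolding prod.shift_bounds_cl_Suc_ivl shift b_def by simp
        finally have "y \<le> a * b * (a ^ k * (\<Prod>j=1..Suc k. g (\<theta> - R - circle_of (real j * \<omega>))))"
          using Suc.prems(2)[of "Suc k"] by (simp only: power_Suc mult_ac)
        then have "y / (a * b) \<le> a ^ k * (\<Prod>j=1..Suc k. g (\<theta> - R - circle_of (real j * \<omega>)))"
          using \<open>0 < b\<close> a by (simp add: pos_divide_le_eq mult_ac)
        then show "min 1 (y / (a * b)) \<le> \<dots>" by simp
      qed simp
      then have "min 1 (a * min 1 (y / (a * b))) \<le> f (u n (\<theta> - R))" by (rule f_mono)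
      \<comment> \<open>The cap costs nothing: when it is active, \<open>a * 1\<close> exceeds 1 and
        \<open>f\<close> saturates.\<close>
      moreover have "min 1 (y / b) \<le> min 1 (a * min 1 (y / (a * b)))"
        using a by (auto simp: min_def)
      moreover have "y / b \<le> 1" using b \<open>0 < b\<close> by simp
      ultimately have "y / b \<le> f (u n (\<theta> - R))" by linarith
      then have "y \<le> f (u n (\<theta> - R)) * b" using \<open>0 < b\<close> by (simp only: pos_divide_le_eq)
      then show ?thesis by (simp only: upper_iterate.simps(2) b_def mult.commute[of "g (\<theta> - R)"])
    qed
  qed simp
  then show ?thesis using LIMSEQ_le_const[OF iterate_tendsto_graph] by blast
qed

lemma continuous_T:
  assumes "continuous_on UNIV g"
  shows "continuous_on UNIV T"
proof -
  have "continuous_on UNIV (\<lambda>z :: circle \<times> real. fst z + R)"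
    using continuous_on_compose2[OF continuous_on_circle_translate continuous_on_fst[OF continuous_on_id]]
    by blast
  moreover have "continuous_on UNIV (\<lambda>z :: circle \<times> real. g (fst z))"
    using continuous_on_compose2[OF assms continuous_on_fst[OF continuous_on_id]] by blast
  ultimately show ?thesis
    unfolding skew_map_def split_def by (intro continuous_intros)
qed

lemma continuous_T_iterate:
  assumes "continuous_on UNIV g"
  shows "continuous_on UNIV (T ^^ n)"
proof (induction n)
  case (Suc n)
  have "continuous_on UNIV (T \<circ> T ^^ n)"
    using Suc continuous_on_subset[OF continuous_T[OF assms] subset_UNIV]
    by (rule continuous_on_compose)
  then show ?case by (simp only: funpow.simps)
qed simp

text \<open>The iterate \<open>T ^^ n\<close> maps the graph into itself and moves this point over
  0. On the graph the base coordinate determines the point, which gives the fibre condition.\<close>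

lemma isolated_preimage:
  assumes "continuous_on UNIV g"
    and "(0, \<phi> 0) isolated_in closure {(\<theta>, \<phi> \<theta>) |\<theta>. True}"
  shows "(- circle_of (real n * \<omega>), \<phi> (- circle_of (real n * \<omega>)))
      isolated_in closure {(\<theta>, \<phi> \<theta>) |\<theta>. True}"
proof (rule isolated_in_closure_preimage[where S = "T ^^ n"])
  show "continuous_on UNIV (T ^^ n)" by (rule continuous_T_iterate[OF assms(1)])
  show "(T ^^ n) (- circle_of (real n * \<omega>), \<phi> (- circle_of (real n * \<omega>)))
      isolated_in closure {(\<theta>, \<phi> \<theta>) |\<theta>. True}"
    unfolding graph_invariant_iterate left_minus by (rule assms(2))
next
  fix w assume "w \<in> {(\<theta>, \<phi> \<theta>) |\<theta>. True}"
  then obtain \<theta> where \<theta>: "w = (\<theta>, \<phi> \<theta>)" by blast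
  show "(T ^^ n) w \<in> {(\<theta>, \<phi> \<theta>) |\<theta>. True}"
    unfolding \<theta> graph_invariant_iterate by blast
  assume "(T ^^ n) w = (T ^^ n) (- circle_of (real n * \<omega>), \<phi> (- circle_of (real n * \<omega>)))"
  then have "\<theta> + circle_of (real n * \<omega>) = - circle_of (real n * \<omega>) + circle_of (real n * \<omega>)"
    unfolding \<theta> graph_invariant_iterate by (rule Pair_inject)
  then have "\<theta> = - circle_of (real n * \<omega>)" by (rule add_right_imp_eq)
  then show "w = (- circle_of (real n * \<omega>), \<phi> (- circle_of (real n * \<omega>)))"
    unfolding \<theta> by simp
qed blast

end

section \<open>The forcing function\<close>

context irrational_cf
begin

text \<open>The plateau has the radius needed in \<open>visit_near_zero\<close>: a point at distance
  between \<open>err (n + 2)\<close> and \<open>err n\<close> from 0, moved by \<open>err n\<close>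
  towards and past 0, lands in it.\<close>

definition bump :: "nat \<Rightarrow> circle \<Rightarrow> real" where
  "bump n \<theta> = max 0 (min 1 ((err n - dist \<theta> 0) / err (Suc (Suc n))))"

definition penalty :: "nat \<Rightarrow> circle \<Rightarrow> real" where
  "penalty N \<theta> = (\<Sum>n. real (q (N + n)) * bump (N + n) \<theta>)"

text \<open>The value at 0 is prescribed, because the penalty series diverges there and
  \<open>suminf\<close> carries no information.\<close>

definition damping :: "real \<Rightarrow> nat \<Rightarrow> circle \<Rightarrow> real" where
  "damping a N \<theta> = (if \<theta> = 0 then 0 else a powr (- penalty N \<theta>))"

lemma bump_nonneg: "0 \<le> bump n \<theta>" and bump_le_1: "bump n \<theta> \<le> 1"
  by (simp_all add: bump_def)

lemma bump_eq_1: "dist \<theta> 0 \<le> err n - err (Suc (Suc n)) \<Longrightarrow> bump n \<theta> = 1"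
  using err_pos[of "Suc (Suc n)"] by (simp add: bump_def)

lemma bump_eq_0: "err n \<le> dist \<theta> 0 \<Longrightarrow> bump n \<theta> = 0"
  using err_pos[of "Suc (Suc n)"] by (simp add: bump_def divide_le_0_iff)

lemma continuous_bump: "continuous_on S (bump n)"
  unfolding bump_def using err_pos[of "Suc (Suc n)"] by (intro continuous_intros) auto

lemma bump_le_indicator: "bump n \<theta> \<le> indicator {\<theta>. dist \<theta> 0 < err n} \<theta>"
  using bump_le_1[of n \<theta>] bump_eq_0[of n \<theta>] by (auto simp: indicator_def not_less)

lemma err_below:
  assumes "0 < x"
  obtains M where "err M < x"
proof -
  have "\<forall>\<^sub>F n in sequentially. err n < x"
    using order_tendstoD(2)[OF err_tendsto_0 assms] .
  then show thesis using that by (auto simp: eventually_sequentially)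
qed

lemma penalty_term_eq_0:
  assumes "err M < dist \<theta> 0" "M \<le> n"
  shows "real (q (N + n)) * bump (N + n) \<theta> = 0"
proof -
  have "err (N + n) \<le> dist \<theta> 0" using assms err_antimono[of M "N + n"] by simp
  then show ?thesis by (simp add: bump_eq_0)
qed

text \<open>The cutoff \<open>M\<close> serves all points outside a fixed ball around 0, so the
  series is locally finite off 0; continuity there rests on this.\<close>

lemma penalty_eq_sum:
  assumes "err M < dist \<theta> 0"
  shows "penalty N \<theta> = (\<Sum>n<M. real (q (N + n)) * bump (N + n) \<theta>)"
  unfolding penalty_def using penalty_term_eq_0[OF assms] by (intro suminf_finite) auto

lemma summable_penalty:
  assumes "\<theta> \<noteq> 0"
  shows "summable (\<lambda>n. real (q (N + n)) * bump (N + n) \<theta>)"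
proof -
  obtain M where "err M < dist \<theta> 0" using err_below[of "dist \<theta> 0"] assms by auto
  then show ?thesis using penalty_term_eq_0 by (intro summable_finite[of "{..<M}"]) auto
qed

lemma penalty_nonneg: "\<theta> \<noteq> 0 \<Longrightarrow> 0 \<le> penalty N \<theta>"
  unfolding penalty_def by (intro suminf_nonneg summable_penalty) (auto simp: bump_nonneg)

lemma penalty_ge:
  assumes "\<theta> \<noteq> 0" "N \<le> n" "dist \<theta> 0 \<le> err n - err (Suc (Suc n))"
  shows "real (q n) \<le> penalty N \<theta>"
proof -
  have "(\<Sum>i\<in>{n - N}. real (q (N + i)) * bump (N + i) \<theta>) \<le> penalty N \<theta>"
    unfolding penalty_def
    by (intro sum_le_suminf summable_penalty assms) (auto simp: bump_nonneg)
  then show ?thesis using assms by (simp add: bump_eq_1)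
qed

lemma damping_le_of_close:
  assumes "1 < a" "N \<le> n" "dist \<theta> 0 \<le> err n - err (Suc (Suc n))"
  shows "damping a N \<theta> \<le> a powr (- real (q n))"
  using assms penalty_ge[of \<theta> N n] by (simp add: damping_def powr_mono)

lemma damping_nonneg: "0 \<le> damping a N \<theta>"
  by (simp add: damping_def)

lemma damping_le_1: "1 < a \<Longrightarrow> damping a N \<theta> \<le> 1"
  using powr_mono[of "- penalty N \<theta>" 0 a] penalty_nonneg[of \<theta> N] by (simp add: damping_def)

lemma damping_eq_0_iff: "1 < a \<Longrightarrow> damping a N \<theta> = 0 \<longleftrightarrow> \<theta> = 0"
  by (simp add: damping_def)

text \<open>Off 0 the penalty is locally a finite sum of continuous terms. Near 0 the plateau of
  bump \<open>n\<close> alone forces a value of at most \<open>a powr - q n\<close>, which tends to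
  0.\<close>

lemma continuous_damping:
  assumes "1 < a"
  shows "continuous_on UNIV (damping a N)"
proof -
  have "isCont (damping a N) \<theta>" for \<theta>
  proof (cases "\<theta> = 0")
    case False
    then obtain M where M: "err M < dist \<theta> 0" using err_below[of "dist \<theta> 0"] by auto
    define U where "U = {\<eta> :: circle. err M < dist \<eta> 0}"
    have "open U" unfolding U_def by (intro open_Collect_less continuous_intros)
    have "continuous_on U (\<lambda>\<eta>. a powr (- (\<Sum>n<M. real (q (N + n)) * bump (N + n) \<eta>)))"
      using assms by (intro continuous_intros continuous_bump) auto
    moreover have "damping a N \<eta> = a powr (- (\<Sum>n<M. real (q (N + n)) * bump (N + n) \<eta>))"
      if "\<eta> \<in> U" for \<eta>
      using that penalty_eq_sum[of M \<eta> N] err_pos[of M] by (auto simp: damping_def U_def)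
    ultimately have "continuous_on U (damping a N)"
      by (metis (no_types, lifting) continuous_on_cong)
    then show ?thesis
      using M \<open>open U\<close> continuous_on_interior[of U "damping a N" \<theta>]
      by (simp add: U_def interior_open)
  next
    case True
    have "damping a N \<midarrow>0\<rightarrow> 0"
    proof (rule metric_LIM_I)
      fix e :: real assume "0 < e"
      have "(\<lambda>n. (1 / a) ^ n) \<longlonglongrightarrow> 0" using assms by (intro LIMSEQ_power_zero) simp
      then have "\<forall>\<^sub>F n in sequentially. (1 / a) ^ n < e \<and> N \<le> n"
        using \<open>0 < e\<close> by (intro eventually_conj eventually_ge_at_top) (rule order_tendstoD(2))
      then obtain n where n: "(1 / a) ^ n < e" "N \<le> n" by (auto simp: eventually_sequentially)
      have "a powr (- real (q n)) \<le> a powr (- real n)"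
        using assms denom_ge[of n] by (intro powr_mono) auto
      also have "\<dots> = (1 / a) ^ n"
        using assms by (simp add: powr_minus powr_realpow power_one_over inverse_eq_divide)
      finally have small: "a powr (- real (q n)) < e" using n by simp
      have "dist (damping a N \<theta>) 0 < e" if "dist \<theta> 0 < err n - err (Suc (Suc n))" for \<theta>
        using damping_le_of_close[OF assms n(2), of \<theta>] that small damping_nonneg[of a N \<theta>] by simp
      then show "\<exists>d>0. \<forall>\<theta>. \<theta> \<noteq> 0 \<and> dist \<theta> 0 < d \<longrightarrow> dist (damping a N \<theta>) 0 < e"
        using err_strict_antimono[of n "Suc (Suc n)"] by (intro exI[of _ "err n - err (Suc (Suc n))"]) auto
    qed
    then show ?thesis unfolding True isCont_def by (simp add: damping_def)
  qed
  then show ?thesis by (simp add: continuous_on_eq_continuous_at)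
qed

section \<open>Integrability of the logarithm\<close>

lemma summable_reciprocals_shift:
  assumes "summable (\<lambda>i. 1 / real (c (Suc i)))"
  shows "summable (\<lambda>n. 1 / real (c (Suc (N + n))))"
  using summable_ignore_initial_segment[OF assms, of N] by (simp add: add.commute)

lemma denom_ratio_le: "real (q n) / real (q (Suc n)) \<le> 1 / real (c (Suc n))"
proof -
  have "real (c (Suc n)) * real (q n) \<le> real (q (Suc n))"
    using denom_step[of n] by (simp flip: of_nat_mult)
  moreover have "0 < real (q (Suc n))" "0 < real (c (Suc n))"
    using denom_pos[of "Suc n"] c_pos[of "Suc n"] by simp_all
  ultimately show ?thesis by (simp add: field_simps)
qed

lemma integrable_bump: "integrable circle_measure (bump n)"
proof -
  interpret finite_measure circle_measure by (rule finite_measure_circle_measure)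
  show ?thesis
    using bump_nonneg[of n] bump_le_1[of n]
    by (intro integrable_const_bound[where B = 1] AE_I2)
       (auto intro!: borel_measurable_circle_measure continuous_bump)
qed

lemma integral_bump_le: "integral\<^sup>L circle_measure (bump n) \<le> 2 * err n"
proof -
  interpret finite_measure circle_measure by (rule finite_measure_circle_measure)
  define B where "B = {\<theta> :: circle. dist \<theta> 0 < err n}"
  have B: "B \<in> sets circle_measure"
  proof -
    have "B = ball 0 (err n)" by (auto simp: B_def dist_commute)
    then show ?thesis by simp
  qed
  have "integral\<^sup>L circle_measure (bump n) \<le> integral\<^sup>L circle_measure (indicator B)"
    using B by (intro integral_mono integrable_bump)
      (auto simp: B_def bump_le_indicator emeasure_eq_measure intro!: integrable_real_indicator)
  also have "\<dots> = measure circle_measure B" using B by simp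
  also have "\<dots> \<le> 2 * err n"
    unfolding B_def using err_pos[of n] by (intro measure_circle_ball_le) simp
  finally show ?thesis .
qed

text \<open>Termwise integration: the series converges off a null set, and the integrals of its
  nonnegative terms are dominated by \<open>2 / c (Suc (N + n))\<close>.\<close>

lemma integrable_penalty:
  assumes "summable (\<lambda>i. 1 / real (c (Suc i)))"
  shows "integrable circle_measure (penalty N)"
proof -
  have norm_eq: "norm (real (q m) * bump m \<theta>) = real (q m) * bump m \<theta>" for m \<theta>
    using bump_nonneg[of m \<theta>] by simp
  have "integrable circle_measure (\<lambda>\<theta>. \<Sum>n. real (q (N + n)) * bump (N + n) \<theta>)"
  proof (rule integrable_suminf)
    show "integrable circle_measure (\<lambda>\<theta>. real (q (N + n)) * bump (N + n) \<theta>)" for n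
      by (intro integrable_mult_right integrable_bump)
    show "AE \<theta> in circle_measure. summable (\<lambda>n. norm (real (q (N + n)) * bump (N + n) \<theta>))"
      unfolding norm_eq using AE_circle_nonzero by (rule AE_mp) (simp add: summable_penalty)
    show "summable (\<lambda>n. \<integral>\<theta>. norm (real (q (N + n)) * bump (N + n) \<theta>) \<partial>circle_measure)"
      unfolding norm_eq
    proof (rule summable_comparison_test')
      show "summable (\<lambda>n. 2 * (1 / real (c (Suc (N + n)))))"
        by (intro summable_mult summable_reciprocals_shift assms)
      fix n :: nat
      have "0 \<le> integral\<^sup>L circle_measure (bump (N + n))"
        by (intro integral_nonneg_AE AE_I2 bump_nonneg)
      then have "norm (\<integral>\<theta>. real (q (N + n)) * bump (N + n) \<theta> \<partial>circle_measure)
          = real (q (N + n)) * integral\<^sup>L circle_measure (bump (N + n))"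
        by simp
      also have "\<dots> \<le> real (q (N + n)) * (2 * err (N + n))"
        by (intro mult_left_mono integral_bump_le) simp
      also have "err (N + n) \<le> 1 / real (q (Suc (N + n)))"
        using denom_err_le[of "N + n"] denom_pos[of "Suc (N + n)"] by (simp add: field_simps)
      then have "real (q (N + n)) * (2 * err (N + n))
          \<le> 2 * (real (q (N + n)) / real (q (Suc (N + n))))"
        using mult_left_mono[of "err (N + n)" "1 / real (q (Suc (N + n)))" "2 * real (q (N + n))"]
        by simp
      also have "\<dots> \<le> 2 * (1 / real (c (Suc (N + n))))"
        by (intro mult_left_mono denom_ratio_le) simp
      finally show "norm (\<integral>\<theta>. real (q (N + n)) * bump (N + n) \<theta> \<partial>circle_measure)
          \<le> 2 * (1 / real (c (Suc (N + n))))" .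
    qed
  qed
  then show ?thesis by (simp only: penalty_def[abs_def])
qed

lemma integrable_ln_damping:
  assumes "1 < a" "summable (\<lambda>i. 1 / real (c (Suc i)))"
  shows "integrable circle_measure (\<lambda>\<theta>. ln (damping a N \<theta>))"
proof (rule integrable_cong_AE_imp)
  show "integrable circle_measure (\<lambda>\<theta>. - ln a * penalty N \<theta>)"
    by (intro integrable_mult_right integrable_penalty assms)
  have "damping a N \<in> borel_measurable circle_measure"
    using continuous_damping[OF assms(1)] by (rule borel_measurable_circle_measure)
  then show "(\<lambda>\<theta>. ln (damping a N \<theta>)) \<in> borel_measurable circle_measure"
    by measurable
  show "AE \<theta> in circle_measure. - ln a * penalty N \<theta> = ln (damping a N \<theta>)"
    using AE_circle_nonzero by (rule AE_mp) (use assms in \<open>simp add: damping_def ln_powr\<close>)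
qed

section \<open>Penalty along the backward orbit of 0\<close>

lemma orbit_nonzero: "1 \<le> j \<Longrightarrow> circle_of (real j * \<omega>) \<noteq> 0"
proof
  assume "1 \<le> j" "circle_of (real j * \<omega>) = 0"
  then have "real j * \<omega> \<in> \<int>" by (simp add: circle_of_0[symmetric] circle_of_eq_iff)
  then have "real j * \<omega> / real j \<in> \<rat>" using Ints_subset_Rats by (intro Rats_divide) auto
  then show False using \<open>1 \<le> j\<close> irrational by simp
qed

lemma orbit_bump_sum:
  "(\<Sum>j=1..k. bump n (- circle_of (real j * \<omega>))) \<le> 2 * real (k div q (Suc n))"
proof -
  define A where "A = {j \<in> {1..k}. \<bar>real j * \<omega> - of_int (round (real j * \<omega>))\<bar> < err n}"
  have "(\<Sum>j=1..k. bump n (- circle_of (real j * \<omega>))) \<le> (\<Sum>j=1..k. if j \<in> A then 1 else 0)"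
  proof (intro sum_mono)
    fix j assume "j \<in> {1..k}"
    then show "bump n (- circle_of (real j * \<omega>)) \<le> (if j \<in> A then 1 else 0)"
      using bump_le_indicator[of n "- circle_of (real j * \<omega>)"]
      by (simp add: A_def dist_circle_uminus_0 dist_circle_of_0 indicator_def of_bool_def)
  qed
  also have "\<dots> = real (card A)"
    by (simp add: sum.If_cases A_def Int_def conj_commute)
  also have "\<dots> \<le> real (2 * (k div q (Suc n)))"
    unfolding A_def using card_returns by (rule of_nat_mono)
  finally show ?thesis by simp
qed

text \<open>In \<open>graph_ge\<close> only \<open>k\<close> factors \<open>a\<close> compensate
  \<open>k + 1\<close> values of \<open>g\<close>, hence the bound \<open>k\<close>. Summing over
  times first, scale \<open>n\<close> costs at most \<open>2 * K / c (Suc (N + n))\<close>, and the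
  tail bound makes the total at most \<open>K / 2\<close>.\<close>

lemma orbit_penalty_sum:
  assumes sum: "summable (\<lambda>i. 1 / real (c (Suc i)))"
    and tail: "(\<Sum>n. 1 / real (c (Suc (N + n)))) \<le> 1/4" and N: "1 \<le> N"
  shows "(\<Sum>j=1..Suc k. penalty N (- circle_of (real j * \<omega>))) \<le> real k"
proof -
  define K where "K = Suc k"
  let ?x = "\<lambda>j. - circle_of (real j * \<omega>)"
  define t where "t n = (\<Sum>j=1..K. real (q (N + n)) * bump (N + n) (?x j))" for n
  have summable: "summable (\<lambda>n. real (q (N + n)) * bump (N + n) (?x j))" if "j \<in> {1..K}" for j
    using that orbit_nonzero[of j] by (intro summable_penalty) auto
  have total: "(\<Sum>j=1..K. penalty N (?x j)) = (\<Sum>n. t n)"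
    unfolding penalty_def t_def by (rule suminf_sum[symmetric]) (rule summable)
  have "summable t"
    unfolding t_def[abs_def] by (rule summable_sum) (rule summable)
  have t_le: "t n \<le> real (q (N + n)) * (2 * real (K div q (Suc (N + n))))" for n
    unfolding t_def sum_distrib_left[symmetric] by (intro mult_left_mono orbit_bump_sum) simp
  show ?thesis
  proof (cases "k = 0")
    \<comment> \<open>For \<open>K = 1\<close> the bound \<open>K / 2\<close> is too weak. Here
      \<open>N \<ge> 1\<close> gives \<open>q (Suc (N + n)) \<ge> 2\<close>, so the integer quotient
      is 0 and no bump is met.\<close>
    case True
    have "t n \<le> 0" for n
    proof -
      have "K < q (Suc (N + n))" using denom_ge[of "Suc (N + n)"] N True by (simp add: K_def)
      then show ?thesis using t_le[of n] by simp
    qed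
    then have "(\<Sum>n. t n) \<le> 0"
      using suminf_le[OF _ \<open>summable t\<close> summable_zero] by simp
    then show ?thesis using total True by (simp add: K_def)
  next
    case False
    have "t n \<le> 2 * real K * (1 / real (c (Suc (N + n))))" for n
    proof -
      have "real (K div q (Suc (N + n))) \<le> real K / real (q (Suc (N + n)))"
        by (rule of_nat_div_le_of_nat)
      then have "t n \<le> real (q (N + n)) * (2 * (real K / real (q (Suc (N + n)))))"
        using t_le[of n] mult_left_mono by (smt (verit) of_nat_0_le_iff)
      also have "\<dots> = 2 * real K * (real (q (N + n)) / real (q (Suc (N + n))))" by simp
      also have "\<dots> \<le> 2 * real K * (1 / real (c (Suc (N + n))))"
        by (intro mult_left_mono denom_ratio_le) simp
      finally show ?thesis .
    qed
    then have "(\<Sum>n. t n) \<le> (\<Sum>n. 2 * real K * (1 / real (c (Suc (N + n)))))"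
      using \<open>summable t\<close> summable_reciprocals_shift[OF sum]
      by (intro suminf_le summable_mult) auto
    also have "\<dots> = 2 * real K * (\<Sum>n. 1 / real (c (Suc (N + n))))"
      by (rule suminf_mult[OF summable_reciprocals_shift[OF sum]])
    also have "\<dots> \<le> 2 * real K * (1/4)" by (intro mult_left_mono tail) simp
    \<comment> \<open>\<open>(k + 1) / 2 \<le> k\<close> holds from \<open>k = 1\<close> on.\<close>
    also have "\<dots> \<le> real k" using False by (simp add: K_def)
    finally show ?thesis using total by (simp add: K_def)
  qed
qed

lemma damping_orbit_prod:
  assumes "1 < a" "summable (\<lambda>i. 1 / real (c (Suc i)))"
    and "(\<Sum>n. 1 / real (c (Suc (N + n)))) \<le> 1/4" "1 \<le> N"
  shows "1 \<le> a ^ k * (\<Prod>j=1..Suc k. damping a N (0 - circle_of (real j * \<omega>)))"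
proof -
  let ?S = "\<Sum>j=1..Suc k. penalty N (- circle_of (real j * \<omega>))"
  have "(\<Prod>j=1..Suc k. damping a N (0 - circle_of (real j * \<omega>)))
      = (\<Prod>j=1..Suc k. a powr (- penalty N (- circle_of (real j * \<omega>))))"
  proof (rule prod.cong)
    fix j assume "j \<in> {1..Suc k}"
    then show "damping a N (0 - circle_of (real j * \<omega>)) = a powr (- penalty N (- circle_of (real j * \<omega>)))"
      using orbit_nonzero[of j] by (simp add: damping_def)
  qed simp
  also have "\<dots> = a powr (- ?S)"
    using assms(1) by (simp only: powr_sum[symmetric] sum_negf)
  finally have "a ^ k * (\<Prod>j=1..Suc k. damping a N (0 - circle_of (real j * \<omega>))) = a powr (real k - ?S)"
    using assms(1) by (simp add: powr_realpow[symmetric] powr_add[symmetric] del: sum.cl_ivl_Suc)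
  moreover have "0 \<le> real k - ?S" using orbit_penalty_sum[OF assms(2-4), of k] by simp
  ultimately show ?thesis using assms(1) by (simp only: ge_one_powr_ge_zero)
qed

section \<open>Points near 0 have visited a plateau\<close>

lemma between_errs:
  assumes "0 < x" "x \<le> err m"
  obtains i where "x \<le> err (m + 2 * i)" "err (Suc (Suc (m + 2 * i))) < x"
proof -
  obtain M where "err M < x" using err_below[OF assms(1)] .
  then have ex: "err (m + 2 * M) < x" using err_antimono[of M "m + 2 * M"] by simp
  \<comment> \<open>Steps of two keep the parity of the index, hence the side of 0 on which the
    convergent point lies.\<close>
  define l where "l = (LEAST l. err (m + 2 * l) < x)"
  have l: "err (m + 2 * l) < x" unfolding l_def using ex by (rule LeastI)
  then have "l \<noteq> 0" using assms(2) by (intro notI) simp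
  then obtain i where i: "l = Suc i" using not0_implies_Suc by blast
  then have "\<not> err (m + 2 * i) < x" unfolding l_def by (intro not_less_Least) simp
  then show thesis using that[of i] l i by simp
qed

text \<open>If \<open>q n * \<omega>\<close> lies on the same side of 0 as \<theta>, subtracting it
  leaves a distance of at most \<open>err n\<close> minus that of \<theta>. This fits into the
  plateau once \<theta> is at distance at least \<open>err (n + 2)\<close>.\<close>

lemma visit_near_zero:
  assumes "\<theta> \<noteq> 0" "dist \<theta> 0 \<le> err (Suc N)"
  obtains n where "N \<le> n"
    "dist (\<theta> - circle_of (real (q n) * \<omega>)) 0 \<le> err n - err (Suc (Suc n))"
proof -
  obtain x where x: "\<theta> = circle_of x" "\<bar>x\<bar> = dist \<theta> 0" using circle_representative .
  have "0 < \<bar>x\<bar>" using x assms(1) by simp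
  \<comment> \<open>Even indices give points to the right of 0, odd ones to the left. The radius
    \<open>err (Suc N)\<close> leaves room for both possible starting indices.\<close>
  define m where "m = (if even N = (0 < x) then N else Suc N)"
  have m: "N \<le> m" "m \<le> Suc N" "even m = (0 < x)" by (auto simp: m_def)
  have "\<bar>x\<bar> \<le> err m" using x assms(2) err_antimono[OF m(2)] by simp
  then obtain i where i: "\<bar>x\<bar> \<le> err (m + 2 * i)" "err (Suc (Suc (m + 2 * i))) < \<bar>x\<bar>"
    using between_errs[OF \<open>0 < \<bar>x\<bar>\<close>] by blast
  define n where "n = m + 2 * i"
  have e: "(-1) ^ n * err n = (if 0 < x then err n else - err n)"
    using m(3) by (auto simp: n_def)
  have "circle_of (real (q n) * \<omega>) = circle_of ((-1) ^ n * err n)"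
    unfolding signed_err[symmetric] circle_of_eq_iff by simp
  then have "dist (\<theta> - circle_of (real (q n) * \<omega>)) 0 = dist (circle_of (x - (-1) ^ n * err n)) (circle_of 0)"
    by (simp add: x(1) circle_of_diff circle_of_0)
  also have "\<dots> \<le> \<bar>x - (-1) ^ n * err n\<bar>"
    using dist_circle_of_le[of "x - (-1) ^ n * err n" 0] by (simp add: dist_real_def)
  also have "\<dots> \<le> err n - err (Suc (Suc n))"
    unfolding e using i n_def by auto
  finally show thesis using that[of n] m(1) n_def by simp
qed

lemma damping_along_orbit:
  assumes "1 < a" "\<theta> \<noteq> 0" "dist \<theta> 0 \<le> err (Suc N)"
  obtains m where "damping a N (\<theta> - circle_of (real (Suc m) * \<omega>)) \<le> a powr (- real (Suc m))"
proof -
  obtain n where n: "N \<le> n"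
    "dist (\<theta> - circle_of (real (q n) * \<omega>)) 0 \<le> err n - err (Suc (Suc n))"
    using visit_near_zero[OF assms(2,3)] .
  obtain m where "q n = Suc m" using denom_pos[of n] gr0_conv_Suc by auto
  then show thesis using damping_le_of_close[OF assms(1) n] that[of m] by simp
qed

end

theorem mainTheorem3:
  fixes \<omega> a :: real and c :: "nat \<Rightarrow> nat" and f :: "real \<Rightarrow> real"
  assumes "\<omega> \<in> {0<..<1}" and "\<omega> \<notin> \<rat>"
    and "has_cf_expansion \<omega> c"
    and "summable (\<lambda>i. 1 / real (c (Suc i)))"
    and "a > 2"
    and "f = (\<lambda>x. min 1 (a * x))"
  shows "\<exists>g :: circle \<Rightarrow> real.
    continuous_on UNIV g \<and> range g \<subseteq> {0..1} \<and>
    (\<forall>\<theta>. g \<theta> = 0 \<longleftrightarrow> \<theta> = 0) \<and>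
    integrable circle_measure (\<lambda>\<theta>. ln (g \<theta>)) \<and>
    (let \<phi> = upper_bounding_graph (skew_map \<omega> g f);
         \<Phi> = {(\<theta>, \<phi> \<theta>) | \<theta>. True}
     in \<phi> 0 = 1 \<and>
        (0, 1) isolated_in closure \<Phi> \<and>
        (\<forall>n::nat. (- circle_of (real n * \<omega>), \<phi> (- circle_of (real n * \<omega>)))
            isolated_in closure \<Phi>) \<and>
        closure \<Phi> \<noteq> {(\<theta>, x). 0 \<le> x \<and> x \<le> \<phi> \<theta>})"
proof -
  interpret irrational_cf \<omega> c using assms by unfold_locales
  have a: "1 < a" using assms by simp
  \<comment> \<open>The constant 1/4 offsets the factor 2 from two-sided returns and the loss
    \<open>K \<le> 2 * k\<close>.\<close>
  obtain M where M: "\<And>n. n \<ge> M \<Longrightarrow> norm (\<Sum>i. 1 / real (c (Suc (i + n)))) < 1/4"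
    using suminf_exist_split[OF _ assms(4), of "1/4"] by auto
  \<comment> \<open>The successor ensures \<open>N \<ge> 1\<close>, as the case of a single backward
    step requires.\<close>
  define N where "N = Suc M"
  have N: "1 \<le> N" "(\<Sum>n. 1 / real (c (Suc (N + n)))) \<le> 1/4"
    using M[of N] by (simp_all add: N_def add.commute)
  define g where "g = damping a N"
  have g: "continuous_on UNIV g" "\<And>\<theta>. 0 \<le> g \<theta>" "\<And>\<theta>. g \<theta> \<le> 1" "\<And>\<theta>. g \<theta> = 0 \<longleftrightarrow> \<theta> = 0"
    "integrable circle_measure (\<lambda>\<theta>. ln (g \<theta>))"
    unfolding g_def using a assms(4)
    by (simp_all add: continuous_damping damping_nonneg damping_le_1 damping_eq_0_iff integrable_ln_damping)
  interpret S: truncated_linear_skew \<omega> a g using a g by unfold_locales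
  define \<phi> where "\<phi> = upper_bounding_graph (skew_map \<omega> g f)"
  define \<Phi> where "\<Phi> = {(\<theta>, \<phi> \<theta>) | \<theta>. True}"
  have "1 \<le> \<phi> 0"
    unfolding \<phi>_def assms(6)
    by (rule S.graph_ge) (simp_all only: g_def damping_orbit_prod[OF a assms(4) N(2,1)] order_refl)
  moreover have "\<phi> 0 \<le> 1" using S.graph_le_iterate[of 0 0] by (simp add: \<phi>_def assms(6))
  ultimately have \<phi>0: "\<phi> 0 = 1" by simp
  \<comment> \<open>The visit at time \<open>Suc m\<close> contributes \<open>a\<close> to the power
    \<open>- Suc m\<close>, later expansion at most \<open>a ^ m\<close>; one factor
    \<open>1 / a\<close> remains.\<close>
  have gap: "\<phi> \<theta> \<le> 1 / a" if \<theta>: "\<theta> \<noteq> 0" "dist \<theta> 0 < err (Suc N)" for \<theta>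
  proof -
    obtain m where "g (\<theta> - circle_of (real (Suc m) * \<omega>)) \<le> a powr (- real (Suc m))"
      unfolding g_def using damping_along_orbit[OF a \<theta>(1) less_imp_le[OF \<theta>(2)]] .
    then have "\<phi> \<theta> \<le> a ^ m * a powr (- real (Suc m))"
      unfolding \<phi>_def assms(6) by (rule S.graph_le_of_visit)
    also have "\<dots> = 1 / a"
      using a by (simp add: powr_realpow[symmetric] powr_add[symmetric] powr_minus_divide)
    finally show ?thesis .
  qed
  have "1 / a < \<phi> 0" using a \<phi>0 by simp
  have "(0, \<phi> 0) isolated_in closure {(\<theta>, \<phi> \<theta>) | \<theta>. True}"
    using err_pos \<open>1 / a < \<phi> 0\<close> gap by (rule graph_isolated_point)
  then have isolated0: "(0, 1) isolated_in closure \<Phi>" by (simp only: \<phi>0 \<Phi>_def)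
  have orbit: "(- circle_of (real n * \<omega>), \<phi> (- circle_of (real n * \<omega>))) isolated_in closure \<Phi>" for n
    unfolding \<Phi>_def \<phi>_def assms(6)
    using g(1) isolated0[folded \<phi>0, unfolded \<Phi>_def \<phi>_def assms(6)] by (rule S.isolated_preimage)
  have "closure \<Phi> \<noteq> {(\<theta>, x). 0 \<le> x \<and> x \<le> \<phi> \<theta>}"
  proof -
    \<comment> \<open>Over 0, heights strictly between \<open>1 / a\<close> and 1 lie below the
      graph but outside its closure.\<close>
    obtain y where y: "1 / a < y" "y < 1" using dense[of "1 / a" 1] a by auto
    moreover have "0 < 1 / a" using a by simp
    then have "0 < y" using y(1) by (rule less_trans)
    ultimately have "(0, y) \<in> {(\<theta>, x). 0 \<le> x \<and> x \<le> \<phi> \<theta>}" using \<phi>0 by simp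
    moreover have "(0, y) \<notin> closure \<Phi>"
      unfolding \<Phi>_def using err_pos \<open>1 / a < \<phi> 0\<close> gap y(1) y(2)[folded \<phi>0]
      by (rule graph_isolated_point(2))
    ultimately show ?thesis by blast
  qed
  then show ?thesis
    using g \<phi>0 isolated0 orbit unfolding \<Phi>_def \<phi>_def Let_def
    by (intro exI[of _ g]) auto
qed

end
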